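(* Let $G$ be a digraph, let $G_1,G_2,\ldots,G_k$ be the strong components of $G$, and let $\mathrm{SC}(G)$ be the strong component digraph of $G$. If $\Delta=\Delta^+(\mathrm{SC}(G))$, then $$\zeta(G)\le \max_{1\le i\le k}\zeta(G_i)+\Delta.$$
   Context: All digraphs are finite, nonempty, simple and oriented (no loops, at most one arc between any two distinct vertices), and need not be strongly connected. The strong components of $G$ are its maximal strongly connected subdigraphs. The strong component digraph $\mathrm{SC}(G)$ is obtained from $G$ by contracting each strong component to a single vertex and deleting resulting loops and parallel arcs: its vertices are the strong components, with an arc from $G_i$ to $G_j$ ($i\ne j$) if some arc of $G$ goes from a vertex of $G_i$ to a vertex of $G_j$. $\Delta^+(H)$ is the maximum out-degree of a digraph $H$. $d(u,v)$ is the length of a shortest directed path from $u$ to $v$, and $d(u,v)=\infty$ if there is no such path. The Localization game with $k$ cops on $G$: an invisible robber first chooses a vertex; in each round the cops choose vertices $u_1,\dots,u_k$ (any vertices, chosen afresh each round) and learn the distance vector $(d(u_1,x),\ldots,d(u_k,x))$, where $x$ is the robber's current vertex; then the robber stays at $x$ or moves along an arc $(x,y)$ to an out-neighbor $y$. The cops win if they have a strategy which, whatever the robber does, after finitely many rounds determines a unique possible vertex for the robber right after a probe (using all information received so far); otherwise the robber wins. The localization number $\zeta(G)$ is the least positive integer $k$ for which $k$ cops have a winning strategy. *)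

theory Defs
  imports "Graph_Theory.Graph_Theory" "HOL-Library.Extended_Nat"
begin

locale oriented_digraph = digraph +
  assumes verts_nonempty: "verts G \<noteq> {}"
    and arcs_asym: "u \<rightarrow> v \<Longrightarrow> \<not> v \<rightarrow> u"

definition max_out_degree :: "('a, 'b) pre_digraph \<Rightarrow> nat" where
  "max_out_degree G = Max (out_degree G ` verts G)"

text \<open>The vertices of the strong component digraph are the components themselves.\<close>

definition strong_component_digraph ::
  "('a, 'b) pre_digraph \<Rightarrow>
    (('a, 'b) pre_digraph, ('a, 'b) pre_digraph \<times> ('a, 'b) pre_digraph) pre_digraph" where
  "strong_component_digraph G =
    \<lparr> verts = pre_digraph.sccs G,
      arcs = {(H, K). H \<in> pre_digraph.sccs G \<and> K \<in> pre_digraph.sccs G \<and> H \<noteq> K \<and>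
                (\<exists>u \<in> verts H. \<exists>v \<in> verts K. u \<rightarrow>\<^bsub>G\<^esub> v)},
      tail = fst,
      head = snd \<rparr>"

text \<open>The infimum over the empty set is \<open>\<infinity>\<close>.\<close>

definition ddist :: "('a, 'b) pre_digraph \<Rightarrow> 'a \<Rightarrow> 'a \<Rightarrow> enat" where
  "ddist G u v = (INF p \<in> {p. pre_digraph.apath G u p v}. enat (length p))"

subsection \<open>The Localization game\<close>

text \<open>
  \<open>r n\<close> is the position of the robber when the probe with index \<open>n\<close> is made; the
  first probe has index 0. A strategy of the cops sends the list of the distance
  vectors received so far, oldest first, to the list of vertices probed next.
  Earlier probes are determined by the strategy and the earlier answers, so they need not
  be recorded.
\<close>

definition robber_walk :: "('a, 'b) pre_digraph \<Rightarrow> (nat \<Rightarrow> 'a) \<Rightarrow> bool" where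
  "robber_walk G r \<longleftrightarrow> r 0 \<in> verts G \<and> (\<forall>n. r (Suc n) = r n \<or> r n \<rightarrow>\<^bsub>G\<^esub> r (Suc n))"

type_synonym 'a cop_strategy = "enat list list \<Rightarrow> 'a list"

definition cop_strategy :: "('a, 'b) pre_digraph \<Rightarrow> nat \<Rightarrow> 'a cop_strategy \<Rightarrow> bool" where
  "cop_strategy G k \<sigma> \<longleftrightarrow> (\<forall>h. length (\<sigma> h) = k \<and> set (\<sigma> h) \<subseteq> verts G)"

primrec answers ::
  "('a, 'b) pre_digraph \<Rightarrow> 'a cop_strategy \<Rightarrow> (nat \<Rightarrow> 'a) \<Rightarrow> nat \<Rightarrow> enat list list" where
  "answers G \<sigma> r 0 = []"
| "answers G \<sigma> r (Suc n) =
    answers G \<sigma> r n @ [map (\<lambda>u. ddist G u (r n)) (\<sigma> (answers G \<sigma> r n))]"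

text \<open>
  The vertices at which the robber may be right after the probe with index \<open>n\<close>, given
  all answers up to and including that probe.
\<close>

definition possible_verts ::
  "('a, 'b) pre_digraph \<Rightarrow> 'a cop_strategy \<Rightarrow> (nat \<Rightarrow> 'a) \<Rightarrow> nat \<Rightarrow> 'a set" where
  "possible_verts G \<sigma> r n =
    {r' n | r'. robber_walk G r' \<and> answers G \<sigma> r' (Suc n) = answers G \<sigma> r (Suc n)}"

definition cops_win :: "('a, 'b) pre_digraph \<Rightarrow> nat \<Rightarrow> bool" where
  "cops_win G k \<longleftrightarrow>
    (\<exists>\<sigma>. cop_strategy G k \<sigma> \<and>
      (\<forall>r. robber_walk G r \<longrightarrow> (\<exists>n v. possible_verts G \<sigma> r n = {v})))"

definition localization_number :: "('a, 'b) pre_digraph \<Rightarrow> nat" where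
  "localization_number G = (LEAST k. 0 < k \<and> cops_win G k)"

text \<open>The minimum in the definition of the localization number is over a nonempty set.\<close>

lemma ddist_eq_0_iff:
  assumes "u \<in> verts G"
  shows "ddist G u v = 0 \<longleftrightarrow> u = v"
proof
  assume d: "ddist G u v = 0"
  have "{p. pre_digraph.apath G u p v} \<noteq> {}"
  proof
    assume "{p. pre_digraph.apath G u p v} = {}"
    with d show False by (simp add: ddist_def top_enat_def)
  qed
  then have "ddist G u v \<in> (\<lambda>p. enat (length p)) ` {p. pre_digraph.apath G u p v}"
    unfolding ddist_def Inf_enat_def by (auto intro: LeastI)
  with d have "pre_digraph.apath G u [] v" by (auto simp: zero_enat_def)
  then show "u = v"
    by (simp add: pre_digraph.apath_def pre_digraph.awalk_def pre_digraph.cas.simps)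
next
  assume "u = v"
  with assms have "pre_digraph.apath G u [] v"
    by (simp add: pre_digraph.apath_def pre_digraph.awalk_def pre_digraph.cas.simps
        pre_digraph.awalk_verts.simps)
  then have "ddist G u v \<le> enat (length [])"
    unfolding ddist_def by (intro INF_lower2[of "[]"]) auto
  then show "ddist G u v = 0" by (simp flip: zero_enat_def)
qed

lemma cops_win_card_verts:
  assumes "fin_digraph G"
  shows "cops_win G (card (verts G))"
proof -
  interpret fin_digraph G by fact
  obtain vs where vs: "set vs = verts G" "distinct vs"
    using finite_distinct_list[OF finite_verts] by blast
  define \<sigma> where "\<sigma> = (\<lambda>h :: enat list list. vs)"
  have "cop_strategy G (card (verts G)) \<sigma>"
    using vs by (auto simp: cop_strategy_def \<sigma>_def distinct_card[symmetric])
  moreover have "possible_verts G \<sigma> r 0 = {r 0}" if r: "robber_walk G r" for r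
  proof -
    have "r' 0 = r 0" if "robber_walk G r'" "answers G \<sigma> r' (Suc 0) = answers G \<sigma> r (Suc 0)" for r'
    proof -
      have "r 0 \<in> verts G" using r by (simp add: robber_walk_def)
      moreover from this have "ddist G (r 0) (r' 0) = ddist G (r 0) (r 0)"
        using that(2) vs by (simp add: \<sigma>_def)
      ultimately show ?thesis by (metis ddist_eq_0_iff)
    qed
    then show ?thesis using r by (auto simp: possible_verts_def)
  qed
  ultimately show ?thesis unfolding cops_win_def by blast
qed

lemma (in oriented_digraph) localization_number_attained:
  "0 < localization_number G \<and> cops_win G (localization_number G)"
proof -
  have "0 < card (verts G) \<and> cops_win G (card (verts G))"
    using verts_nonempty cops_win_card_verts[OF fin_digraph] by (simp add: card_gt_0_iff)
  then show ?thesis unfolding localization_number_def by (rule LeastI)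
qed

end

theory Submission
  imports Defs
begin

text \<open>
  A strong component \<open>H\<close> can be searched in isolation, because a directed path between two of its
  vertices never leaves it: a probe at a vertex of \<open>H\<close> returns the same distance to a robber in
  \<open>H\<close> whether it is measured in \<open>H\<close> or in \<open>G\<close> (\<open>ddist_sccs\<close>). What must be added is a way to notice
  that the robber is not in \<open>H\<close>. A robber that cannot be reached from \<open>H\<close> is betrayed by an infinite
  distance from any probe in \<open>H\<close>. A robber that is reachable from \<open>H\<close> but outside of it
  is reachable from some out-neighbour of \<open>H\<close> in the strong component digraph, whereas no vertex
  of \<open>H\<close> is reachable from there. So one guard in each out-neighbour, that is at most \<open>\<Delta>\<close> guards,
  makes every answer decide whether the robber is in \<open>H\<close> (\<open>guards_of_scc\<close>).

  The cops therefore visit the components in a topological order. In each component they play its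
  own winning strategy, together with the guards, until an answer shows that the robber is
  elsewhere; then they start afresh in the next one. Since the order is topological, a robber that
  has been seen outside the current component, and that was not in an earlier one, can never enter
  any of them later. The component is changed only finitely often, so from some round on the robber
  stays for ever in the component being searched. There he is located: every walk compatible with
  all answers was in that component at the same rounds and gave there the same answers to its
  strategy.

  In the formal proof the topological order is implicit. A set \<open>U\<close> of vertices without arcs
  leaving it stands for the region in which the robber is known to be.
  If \<open>U\<close> is nonempty, it contains a strong component that no arc from the rest of \<open>U\<close> enters
  (\<open>source_scc\<close>); a strategy for \<open>U\<close> is composed of one for this component and one for
  the rest of \<open>U\<close> (\<open>locates_from_handover\<close>, \<open>locates_from_peel_scc\<close>), and induction on \<open>U\<close> does
  the rest (\<open>locates_from_closed\<close>).
\<close>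

section \<open>Walks and answers\<close>

lemma length_answers [simp]: "length (answers G \<sigma> r n) = n"
  by (induction n) auto

lemma take_answers: "n \<le> m \<Longrightarrow> take n (answers G \<sigma> r m) = answers G \<sigma> r n"
proof (induction m)
  case (Suc m)
  then show ?case by (cases "n = Suc m") auto
qed simp

lemma answers_eq_le:
  assumes "answers G \<sigma> r m = answers G \<sigma> r' m" "n \<le> m"
  shows "answers G \<sigma> r n = answers G \<sigma> r' n"
  using assms by (metis take_answers)

lemma answers_cong:
  assumes "\<And>j. j < n \<Longrightarrow> r j = r' j"
  shows "answers G \<sigma> r n = answers G \<sigma> r' n"
  using assms by (induction n) auto

lemma robber_walk_in_closed:
  assumes "robber_walk G r" "r 0 \<in> U" "\<And>x y. x \<in> U \<Longrightarrow> x \<rightarrow>\<^bsub>G\<^esub> y \<Longrightarrow> y \<in> U"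
  shows "r n \<in> U"
proof (induction n)
  case (Suc n)
  then show ?case using assms(1,3) by (metis robber_walk_def)
qed (use assms in simp)

lemma (in wf_digraph) robber_walk_in_verts: "robber_walk G r \<Longrightarrow> r n \<in> verts G"
  by (rule robber_walk_in_closed[of G]) (auto simp: robber_walk_def adj_in_verts)

lemma (in wf_digraph) robber_walk_shift:
  "robber_walk G r \<Longrightarrow> robber_walk G (\<lambda>i. r (n + i))"
  using robber_walk_in_verts by (auto simp: robber_walk_def)


section \<open>Locating a robber with known starting set\<close>

text \<open>
  The game in which the cops know in advance that the robber starts in \<open>U\<close>. This
  advance knowledge is what they keep of the past once they give up a component, so it is
  the form in which the game can be treated by induction. The condition on \<open>r n\<close> says that the set
  of possible vertices is a singleton.
\<close>

definition locates_from :: "('a, 'b) pre_digraph \<Rightarrow> nat \<Rightarrow> 'a set \<Rightarrow> bool" where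
  "locates_from G k U \<longleftrightarrow>
    (\<exists>\<sigma>. cop_strategy G k \<sigma> \<and>
      (\<forall>r. robber_walk G r \<and> r 0 \<in> U \<longrightarrow>
        (\<exists>n. \<forall>r'. robber_walk G r' \<and> r' 0 \<in> U \<and>
          answers G \<sigma> r' (Suc n) = answers G \<sigma> r (Suc n) \<longrightarrow> r' n = r n)))"

lemma cops_win_iff_locates_from_verts: "cops_win G k \<longleftrightarrow> locates_from G k (verts G)"
proof -
  have "(\<exists>v. possible_verts G \<sigma> r n = {v}) \<longleftrightarrow>
    (\<forall>r'. robber_walk G r' \<and> r' 0 \<in> verts G \<and>
      answers G \<sigma> r' (Suc n) = answers G \<sigma> r (Suc n) \<longrightarrow> r' n = r n)"
    if r: "robber_walk G r" for \<sigma> r n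
  proof -
    have "r n \<in> possible_verts G \<sigma> r n" using r by (auto simp: possible_verts_def)
    then have "(\<exists>v. possible_verts G \<sigma> r n = {v}) \<longleftrightarrow> (\<forall>x \<in> possible_verts G \<sigma> r n. x = r n)"
      by auto
    then show ?thesis
      by (auto simp: possible_verts_def robber_walk_def simp del: answers.simps)
  qed
  moreover have "robber_walk G r \<and> r 0 \<in> verts G \<longleftrightarrow> robber_walk G r" for r
    by (auto simp: robber_walk_def)
  ultimately show ?thesis
    unfolding cops_win_def locates_from_def by (simp del: answers.simps cong: imp_cong)
qed

text \<open>Superfluous cops probe a fixed vertex, and their answers are dropped.\<close>

lemma locates_from_mono:
  assumes "locates_from G m U" "m \<le> k" "verts G \<noteq> {}"
  shows "locates_from G k U"
proof -
  obtain v where v: "v \<in> verts G" using assms by auto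
  obtain \<sigma> where \<sigma>: "cop_strategy G m \<sigma>"
    and win: "\<And>r. robber_walk G r \<Longrightarrow> r 0 \<in> U \<Longrightarrow>
        (\<exists>n. \<forall>r'. robber_walk G r' \<and> r' 0 \<in> U \<and>
          answers G \<sigma> r' (Suc n) = answers G \<sigma> r (Suc n) \<longrightarrow> r' n = r n)"
    using assms(1) unfolding locates_from_def by blast
  define \<sigma>' where "\<sigma>' h = \<sigma> (map (take m) h) @ replicate (k - m) v" for h
  have "cop_strategy G k \<sigma>'"
    using \<sigma> v assms(2) by (auto simp: cop_strategy_def \<sigma>'_def)
  moreover have ans: "map (take m) (answers G \<sigma>' r n) = answers G \<sigma> r n" for r n
    using \<sigma> by (induction n) (auto simp: cop_strategy_def \<sigma>'_def)
  moreover have "\<exists>n. \<forall>r'. robber_walk G r' \<and> r' 0 \<in> U \<and>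
          answers G \<sigma>' r' (Suc n) = answers G \<sigma>' r (Suc n) \<longrightarrow> r' n = r n"
    if "robber_walk G r" "r 0 \<in> U" for r
    using win[OF that] ans by metis
  ultimately show ?thesis unfolding locates_from_def by blast
qed

section \<open>Handing over from one strategy to another\<close>

text \<open>
  Play \<open>\<sigma>\<close> as long as all answers satisfy \<open>P\<close>. The first answer that violates \<open>P\<close> is discarded,
  and from then on \<open>\<tau>\<close> is played with the empty history.
\<close>

definition handover ::
  "(enat list \<Rightarrow> bool) \<Rightarrow> 'a cop_strategy \<Rightarrow> 'a cop_strategy \<Rightarrow> 'a cop_strategy" where
  "handover P \<sigma> \<tau> h = (if \<forall>a \<in> set h. P a then \<sigma> h else \<tau> (tl (dropWhile P h)))"

lemma answers_handover_before:
  assumes "\<forall>a \<in> set (answers G \<sigma> r n). P a"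
  shows "answers G (handover P \<sigma> \<tau>) r n = answers G \<sigma> r n"
  using assms by (induction n) (auto simp: handover_def)

lemma answers_handover_after:
  assumes "\<forall>a \<in> set (answers G (handover P \<sigma> \<tau>) r n). P a"
    and "\<not> P (last (answers G (handover P \<sigma> \<tau>) r (Suc n)))"
  shows "answers G (handover P \<sigma> \<tau>) r (Suc n + j) =
    answers G (handover P \<sigma> \<tau>) r (Suc n) @ answers G \<tau> (\<lambda>i. r (Suc n + i)) j"
proof (induction j)
  case (Suc j)
  have "handover P \<sigma> \<tau> (answers G (handover P \<sigma> \<tau>) r (Suc n + j))
      = \<tau> (answers G \<tau> (\<lambda>i. r (Suc n + i)) j)"
    unfolding Suc.IH using assms by (simp add: handover_def)
  with Suc show ?case by simp
qed simp

text \<open>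
  Either the robber stays in \<open>S\<close> for ever, and the play is one of \<open>\<sigma>\<close>, or he is outside \<open>S\<close> at a
  first round \<open>n\<close>, and the play from the next round on is one of \<open>\<tau>\<close>. Because the answers decide
  membership in \<open>S\<close>, all walks with the same answers fall into the same case, with the same \<open>n\<close>.
  In the first case a competing walk is only known to be in \<open>S\<close> up to the round at which the
  robber is located, hence the bounded quantifier in the hypothesis on \<open>\<sigma>\<close>.
\<close>

lemma (in wf_digraph) locates_from_handover:
  assumes \<sigma>: "cop_strategy G k \<sigma>"
    and test: "\<And>h x. x \<in> verts G \<Longrightarrow> P (map (\<lambda>u. ddist G u x) (\<sigma> h)) \<longleftrightarrow> x \<in> S"
    and inside: "\<And>r. robber_walk G r \<Longrightarrow> (\<forall>n. r n \<in> S) \<Longrightarrow>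
        \<exists>n. \<forall>r'. robber_walk G r' \<and> (\<forall>j \<le> n. r' j \<in> S) \<and>
          answers G \<sigma> r' (Suc n) = answers G \<sigma> r (Suc n) \<longrightarrow> r' n = r n"
    and closed: "\<And>x y. x \<in> U \<Longrightarrow> x \<rightarrow>\<^bsub>G\<^esub> y \<Longrightarrow> y \<in> U"
    and closed': "\<And>x y. x \<in> U - S \<Longrightarrow> x \<rightarrow>\<^bsub>G\<^esub> y \<Longrightarrow> y \<in> U - S"
    and outside: "locates_from G k (U - S)"
  shows "locates_from G k U"
proof -
  obtain \<tau> where \<tau>: "cop_strategy G k \<tau>"
    and win: "\<And>r. robber_walk G r \<Longrightarrow> r 0 \<in> U - S \<Longrightarrow>
        (\<exists>n. \<forall>r'. robber_walk G r' \<and> r' 0 \<in> U - S \<and>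
          answers G \<tau> r' (Suc n) = answers G \<tau> r (Suc n) \<longrightarrow> r' n = r n)"
    using outside unfolding locates_from_def by blast
  define \<kappa> where "\<kappa> = handover P \<sigma> \<tau>"
  have \<kappa>: "cop_strategy G k \<kappa>"
    using \<sigma> \<tau> by (auto simp: cop_strategy_def \<kappa>_def handover_def)
  have \<sigma>_iff: "(\<forall>a \<in> set (answers G \<sigma> r n). P a) \<longleftrightarrow> (\<forall>j<n. r j \<in> S)"
    if "robber_walk G r" for r n
    by (induction n) (auto simp: test robber_walk_in_verts[OF that] less_Suc_eq)
  have \<kappa>_iff: "(\<forall>a \<in> set (answers G \<kappa> r n). P a) \<longleftrightarrow> (\<forall>j<n. r j \<in> S)"
    if "robber_walk G r" for r n
  proof (induction n)
    case (Suc n)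
    then show ?case
      by (auto simp: test robber_walk_in_verts[OF that] less_Suc_eq \<kappa>_def handover_def)
  qed simp
  have before: "answers G \<kappa> r n = answers G \<sigma> r n"
    if "robber_walk G r" "\<forall>j<n. r j \<in> S" for r n
    unfolding \<kappa>_def using that by (intro answers_handover_before) (simp add: \<sigma>_iff)
  have after: "answers G \<kappa> r (Suc n + j) = answers G \<kappa> r (Suc n) @ answers G \<tau> (\<lambda>i. r (Suc n + i)) j"
    if "robber_walk G r" "\<forall>j<n. r j \<in> S" "r n \<notin> S" for r n j
  proof -
    have *: "\<forall>a \<in> set (answers G \<kappa> r n). P a" using that \<kappa>_iff by blast
    moreover have "\<not> P (last (answers G \<kappa> r (Suc n)))"
      using * that \<kappa>_iff[of r "Suc n"] by auto
    ultimately show ?thesis unfolding \<kappa>_def by (rule answers_handover_after)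
  qed
  have "\<exists>n. \<forall>r'. robber_walk G r' \<and> r' 0 \<in> U \<and>
          answers G \<kappa> r' (Suc n) = answers G \<kappa> r (Suc n) \<longrightarrow> r' n = r n"
    if r: "robber_walk G r" "r 0 \<in> U" for r
  proof (cases "\<forall>n. r n \<in> S")
    case True
    from inside[OF r(1) True] obtain n where n: "\<And>r'. robber_walk G r' \<Longrightarrow> \<forall>j \<le> n. r' j \<in> S \<Longrightarrow>
          answers G \<sigma> r' (Suc n) = answers G \<sigma> r (Suc n) \<Longrightarrow> r' n = r n"
      by blast
    have "r' n = r n" if r': "robber_walk G r'" "answers G \<kappa> r' (Suc n) = answers G \<kappa> r (Suc n)" for r'
    proof (rule n[OF r'(1)])
      have *: "\<forall>j < Suc n. r' j \<in> S"
        using \<kappa>_iff[OF r'(1), of "Suc n"] \<kappa>_iff[OF r(1), of "Suc n"] r'(2) True by metis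
      then show "\<forall>j \<le> n. r' j \<in> S" by auto
      show "answers G \<sigma> r' (Suc n) = answers G \<sigma> r (Suc n)"
        using before[OF r'(1) *] before[OF r(1), of "Suc n"] True r'(2) by metis
    qed
    then show ?thesis by blast
  next
    case False
    define n where "n = (LEAST n. r n \<notin> S)"
    have n: "r n \<notin> S" using False unfolding n_def by (metis (mono_tags, lifting) LeastI)
    have less_n: "\<forall>j<n. r j \<in> S" unfolding n_def using not_less_Least by blast
    have in_U: "s i \<in> U" if "robber_walk G s" "s 0 \<in> U" for s i
      using robber_walk_in_closed[OF that closed] .
    have out: "s (Suc n) \<in> U - S" if s: "robber_walk G s" "s 0 \<in> U" "s n \<notin> S" for s
      using in_U[OF s(1,2), of n] s(1,3) closed'[of "s n" "s (Suc n)"]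
      by (metis DiffI robber_walk_def)
    from win[OF robber_walk_shift[OF r(1), of "Suc n"]] out[OF r n]
    obtain m where m: "\<And>r'. robber_walk G r' \<Longrightarrow> r' 0 \<in> U - S \<Longrightarrow>
          answers G \<tau> r' (Suc m) = answers G \<tau> (\<lambda>i. r (Suc n + i)) (Suc m) \<Longrightarrow> r' m = r (Suc n + m)"
      by auto
    have "r' (Suc n + m) = r (Suc n + m)"
      if r': "robber_walk G r'" "r' 0 \<in> U"
        "answers G \<kappa> r' (Suc (Suc n + m)) = answers G \<kappa> r (Suc (Suc n + m))" for r'
    proof -
      have eq: "answers G \<kappa> r' j = answers G \<kappa> r j" if "j \<le> Suc (Suc n + m)" for j
        using answers_eq_le[OF r'(3) that] .
      have less: "\<forall>j<n. r' j \<in> S"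
        using \<kappa>_iff[OF r'(1), of n] \<kappa>_iff[OF r(1), of n] eq[of n] less_n by simp
      moreover have "\<not> (\<forall>j<Suc n. r' j \<in> S)"
        using \<kappa>_iff[OF r'(1), of "Suc n"] \<kappa>_iff[OF r(1), of "Suc n"] eq[of "Suc n"] n
        by (metis lessI le_add1 le_SucI)
      ultimately have nin: "r' n \<notin> S" by (auto simp: less_Suc_eq)
      have "answers G \<tau> (\<lambda>i. r' (Suc n + i)) (Suc m) = answers G \<tau> (\<lambda>i. r (Suc n + i)) (Suc m)"
        using after[OF r'(1) less nin, of "Suc m"] after[OF r(1) less_n n, of "Suc m"]
          eq[of "Suc n + Suc m"] eq[of "Suc n"]
        by (simp del: answers.simps)
      from m[OF robber_walk_shift[OF r'(1)] _ this] out[OF r'(1,2) nin]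
      show ?thesis by simp
    qed
    then show ?thesis by blast
  qed
  with \<kappa> show ?thesis unfolding locates_from_def by blast
qed

section \<open>Strong components\<close>

context wf_digraph
begin

lemma sccs_reachable:
  assumes "H \<in> sccs" "u \<in> verts H" "v \<in> verts H"
  shows "u \<rightarrow>\<^sup>*\<^bsub>G\<^esub> v"
  using in_sccs_vertsI_sccs[of "verts H"] assms unfolding in_sccs_verts_conv_reachable by blast

lemma in_sccsI_reachable:
  assumes "H \<in> sccs" "u \<in> verts H" "u \<rightarrow>\<^sup>*\<^bsub>G\<^esub> v" "v \<rightarrow>\<^sup>*\<^bsub>G\<^esub> u"
  shows "v \<in> verts H"
  using in_sccs_vertsI_sccs[of "verts H"] assms unfolding in_sccs_verts_conv_reachable by blast

lemma ex_scc:
  assumes "u \<in> verts G"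
  obtains H where "H \<in> sccs" "u \<in> verts H"
  using scc_of_in_sccs_verts[OF assms] in_scc_of_self[OF assms] sccs_verts_conv by auto

lemma sccs_verts_subset: "H \<in> sccs \<Longrightarrow> verts H \<subseteq> verts G"
  by (auto dest!: in_sccs_imp_induced)

lemma sccs_adj_iff:
  assumes "H \<in> sccs" "u \<in> verts H" "v \<in> verts H"
  shows "u \<rightarrow>\<^bsub>H\<^esub> v \<longleftrightarrow> u \<rightarrow>\<^bsub>G\<^esub> v"
proof -
  have "induced_subgraph H G" using assms(1) by (rule in_sccs_imp_induced)
  then show ?thesis using assms
    by (auto simp: induced_subgraph_def subgraph_def compatible_def arcs_ends_def arc_to_ends_def)
qed

lemma robber_walk_sccs:
  assumes "H \<in> sccs" "\<And>n. r n \<in> verts H"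
  shows "robber_walk H r \<longleftrightarrow> robber_walk G r"
  using assms sccs_verts_subset by (auto simp: robber_walk_def sccs_adj_iff)

text \<open>
  An intermediate vertex of a walk between two vertices of a strong component is reachable from the
  first and reaches the last of them, so it lies in the component.
\<close>

lemma awalk_in_sccs:
  assumes H: "H \<in> sccs" and v: "v \<in> verts H"
  shows "u \<in> verts H \<Longrightarrow> awalk u p v \<Longrightarrow> pre_digraph.awalk H u p v"
proof (induction p arbitrary: u)
  case Nil
  then show ?case by (simp add: pre_digraph.awalk_def pre_digraph.cas.simps)
next
  case (Cons e p)
  have ind: "induced_subgraph H G" using H by (rule in_sccs_imp_induced)
  have e: "e \<in> arcs G" "tail G e = u" and p: "awalk (head G e) p v"
    using Cons.prems(2) by (auto simp: awalk_Cons_iff)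
  have "u \<rightarrow>\<^bsub>G\<^esub> head G e" using e by (auto simp: arcs_ends_def arc_to_ends_def)
  moreover have "head G e \<rightarrow>\<^sup>*\<^bsub>G\<^esub> u"
    using p sccs_reachable[OF H v Cons.prems(1)] by (blast intro: reachable_awalkI reachable_trans)
  ultimately have "head G e \<in> verts H"
    using in_sccsI_reachable[OF H Cons.prems(1)] by auto
  with Cons.IH[OF this p] e ind Cons.prems(1) show ?case
    by (auto simp: pre_digraph.awalk_def pre_digraph.cas.simps induced_subgraph_def subgraph_def
        compatible_def)
qed

lemma apath_sccs_iff:
  assumes H: "H \<in> sccs" and "u \<in> verts H" "v \<in> verts H"
  shows "pre_digraph.apath H u p v \<longleftrightarrow> apath u p v"
proof -
  have sub: "subgraph H G" using H by (auto dest: in_sccs_imp_induced induced_imp_subgraph)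
  then have "compatible G H" by auto
  then show ?thesis
    using subgraph_apath_imp_apath[OF _ sub] awalk_in_sccs[OF H assms(3,2)]
    by (auto simp: pre_digraph.apath_def compatible_awalk_verts)
qed

lemma ddist_sccs:
  assumes "H \<in> sccs" "u \<in> verts H" "v \<in> verts H"
  shows "ddist H u v = ddist G u v"
  unfolding ddist_def apath_sccs_iff[OF assms] ..

lemma ddist_eq_infinity_iff: "ddist G u v = \<infinity> \<longleftrightarrow> \<not> u \<rightarrow>\<^sup>*\<^bsub>G\<^esub> v"
  unfolding ddist_def reachable_apath by (simp add: INF_top_conv flip: top_enat_def) (simp add: top_enat_def)

text \<open>
  Take the arc by which a path to \<open>x\<close> leaves \<open>H\<close>; its head lies in an out-neighbour \<open>K\<close>
  of \<open>H\<close>, and all vertices of \<open>K\<close> reach \<open>x\<close> through it.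
\<close>

lemma leave_scc:
  assumes "H \<in> sccs" "u \<rightarrow>\<^sup>*\<^bsub>G\<^esub> x" "u \<in> verts H" "x \<notin> verts H"
  obtains K where "(H, K) \<in> arcs (strong_component_digraph G)" "K \<in> sccs"
    "\<And>w. w \<in> verts K \<Longrightarrow> w \<rightarrow>\<^sup>*\<^bsub>G\<^esub> x"
proof -
  have "\<exists>y \<in> verts H. \<exists>z. z \<notin> verts H \<and> y \<rightarrow>\<^bsub>G\<^esub> z \<and> z \<rightarrow>\<^sup>*\<^bsub>G\<^esub> x"
    using assms(2-4)
  proof (induction rule: converse_reachable_induct)
    case (step u v)
    then show ?case by (cases "v \<in> verts H") auto
  qed simp
  then obtain y z where yz: "y \<in> verts H" "z \<notin> verts H" "y \<rightarrow>\<^bsub>G\<^esub> z" "z \<rightarrow>\<^sup>*\<^bsub>G\<^esub> x" by blast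
  obtain K where K: "K \<in> sccs" "z \<in> verts K" using ex_scc adj_in_verts(2)[OF yz(3)] by blast
  show ?thesis
  proof
    show "(H, K) \<in> arcs (strong_component_digraph G)"
      using assms(1) yz K by (auto simp: strong_component_digraph_def)
    show "w \<rightarrow>\<^sup>*\<^bsub>G\<^esub> x" if "w \<in> verts K" for w
      using sccs_reachable[OF K(1) that K(2)] yz(4) by (rule reachable_trans)
  qed (rule K)
qed

text \<open>Otherwise \<open>H\<close> and \<open>K\<close> would be mutually reachable, hence the same component.\<close>

lemma no_return_to_scc:
  assumes HK: "(H, K) \<in> arcs (strong_component_digraph G)"
    and w: "w \<in> verts K" and x: "x \<in> verts H"
  shows "\<not> w \<rightarrow>\<^sup>*\<^bsub>G\<^esub> x"
proof
  assume wx: "w \<rightarrow>\<^sup>*\<^bsub>G\<^esub> x"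
  from HK obtain y z where H: "H \<in> sccs" and K: "K \<in> sccs" and "H \<noteq> K"
    and y: "y \<in> verts H" and z: "z \<in> verts K" and "y \<rightarrow>\<^bsub>G\<^esub> z"
    by (auto simp: strong_component_digraph_def)
  have "x \<rightarrow>\<^sup>*\<^bsub>G\<^esub> w"
    using sccs_reachable[OF H x y] \<open>y \<rightarrow>\<^bsub>G\<^esub> z\<close> sccs_reachable[OF K z w]
    by (meson reachable_adjI reachable_trans)
  with wx have "w \<in> verts H" using in_sccsI_reachable[OF H x] by blast
  with w \<open>H \<noteq> K\<close> show False using scc_disj[OF H K] by blast
qed

end

lemma (in oriented_digraph) sccs_oriented_digraph:
  assumes H: "H \<in> sccs"
  shows "oriented_digraph H"
proof -
  have sub: "subgraph H G" using H by (auto dest: in_sccs_imp_induced induced_imp_subgraph)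
  interpret H: digraph H using sub by (rule digraph_subgraph)
  show ?thesis
  proof
    show "verts H \<noteq> {}" using H by (auto simp: sccs_def strongly_connected_def)
    show "\<not> v \<rightarrow>\<^bsub>H\<^esub> u" if "u \<rightarrow>\<^bsub>H\<^esub> v" for u v
      using that arcs_asym arcs_ends_mono[OF sub] by blast
  qed
qed

lemma (in fin_digraph) finite_sccs: "finite sccs"
  using finite_sccs_verts inj_on_verts_sccs by (simp add: sccs_verts_conv finite_image_iff)

section \<open>Guarding a strong component\<close>

text \<open>
  One vertex is chosen in each out-neighbour of \<open>H\<close>. For the robber's vertex \<open>x\<close> and a probe
  \<open>u\<close> in \<open>H\<close>, both \<open>u \<rightarrow>\<^sup>* x\<close> and the reachability of \<open>x\<close> from the guards can be read off the
  answer, as the finiteness of distances.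
\<close>

lemma (in fin_digraph) guards_of_scc:
  assumes H: "H \<in> sccs"
  obtains ws where "length ws = out_degree (strong_component_digraph G) H" "set ws \<subseteq> verts G"
    "\<And>u x. u \<in> verts H \<Longrightarrow> u \<rightarrow>\<^sup>*\<^bsub>G\<^esub> x \<Longrightarrow> x \<in> verts H \<longleftrightarrow> (\<forall>w \<in> set ws. \<not> w \<rightarrow>\<^sup>*\<^bsub>G\<^esub> x)"
proof -
  let ?A = "out_arcs (strong_component_digraph G) H"
  have A: "e \<in> ?A \<longleftrightarrow> e \<in> arcs (strong_component_digraph G) \<and> fst e = H" for e
    by (auto simp: out_arcs_def strong_component_digraph_def)
  have "?A \<subseteq> sccs \<times> sccs"
    by (auto simp: out_arcs_def strong_component_digraph_def)
  then have "finite ?A" using finite_sccs by (metis finite_SigmaI finite_subset)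
  then obtain es where es: "set es = ?A" "distinct es" using finite_distinct_list by blast
  define g where "g e = (SOME w. w \<in> verts (snd e))" for e :: "('a, 'b) pre_digraph \<times> ('a, 'b) pre_digraph"
  have snd_scc: "snd e \<in> sccs" if "e \<in> ?A" for e
    using that by (auto simp: out_arcs_def strong_component_digraph_def)
  have g: "g e \<in> verts (snd e)" if "e \<in> ?A" for e
    using snd_scc[OF that] unfolding g_def
    by (auto simp: sccs_def strongly_connected_def some_in_eq)
  show ?thesis
  proof
    show "length (map g es) = out_degree (strong_component_digraph G) H"
      using es by (simp add: out_degree_def flip: distinct_card)
    show "set (map g es) \<subseteq> verts G"
      using g snd_scc sccs_verts_subset es by fastforce
    show "x \<in> verts H \<longleftrightarrow> (\<forall>w \<in> set (map g es). \<not> w \<rightarrow>\<^sup>*\<^bsub>G\<^esub> x)"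
      if u: "u \<in> verts H" "u \<rightarrow>\<^sup>*\<^bsub>G\<^esub> x" for u x
    proof
      assume x: "x \<in> verts H"
      show "\<forall>w \<in> set (map g es). \<not> w \<rightarrow>\<^sup>*\<^bsub>G\<^esub> x"
        using es A g no_return_to_scc[OF _ _ x] by fastforce
    next
      assume none: "\<forall>w \<in> set (map g es). \<not> w \<rightarrow>\<^sup>*\<^bsub>G\<^esub> x"
      show "x \<in> verts H"
      proof (rule ccontr)
        assume "x \<notin> verts H"
        from leave_scc[OF H u(2,1) this] obtain K
          where "(H, K) \<in> arcs (strong_component_digraph G)" "\<And>w. w \<in> verts K \<Longrightarrow> w \<rightarrow>\<^sup>*\<^bsub>G\<^esub> x"
          by metis
        then show False using none es A[of "(H, K)"] g[of "(H, K)"] by force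
      qed
    qed
  qed
qed

text \<open>
  The \<open>k\<close> cops are split into the guards of \<open>H\<close> and \<open>l \<ge> m\<close> others, who play in \<open>H\<close>.
\<close>

lemma (in fin_digraph) locates_from_peel_scc:
  assumes H: "H \<in> sccs"
    and win: "cops_win H m" and "0 < m"
    and k: "m + out_degree (strong_component_digraph G) H \<le> k"
    and closed: "\<And>x y. x \<in> U \<Longrightarrow> x \<rightarrow>\<^bsub>G\<^esub> y \<Longrightarrow> y \<in> U"
    and closed': "\<And>x y. x \<in> U - verts H \<Longrightarrow> x \<rightarrow>\<^bsub>G\<^esub> y \<Longrightarrow> y \<in> U - verts H"
    and outside: "locates_from G k (U - verts H)"
  shows "locates_from G k U"
proof -
  obtain ws where len: "length ws = out_degree (strong_component_digraph G) H"
    and ws: "set ws \<subseteq> verts G"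
    and guard: "\<And>u x. u \<in> verts H \<Longrightarrow> u \<rightarrow>\<^sup>*\<^bsub>G\<^esub> x \<Longrightarrow> x \<in> verts H \<longleftrightarrow> (\<forall>w \<in> set ws. \<not> w \<rightarrow>\<^sup>*\<^bsub>G\<^esub> x)"
    using guards_of_scc[OF H] by blast
  define l where "l = k - length ws"
  have l: "m \<le> l" "l + length ws = k" using k len by (auto simp: l_def)
  have "verts H \<noteq> {}" using H by (auto simp: sccs_def strongly_connected_def)
  with win l(1) have "locates_from H l (verts H)"
    by (auto simp: cops_win_iff_locates_from_verts intro: locates_from_mono)
  then obtain \<sigma> where \<sigma>: "cop_strategy H l \<sigma>"
    and \<sigma>_win: "\<And>r. robber_walk H r \<Longrightarrow> r 0 \<in> verts H \<Longrightarrow>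
        (\<exists>n. \<forall>r'. robber_walk H r' \<and> r' 0 \<in> verts H \<and>
          answers H \<sigma> r' (Suc n) = answers H \<sigma> r (Suc n) \<longrightarrow> r' n = r n)"
    unfolding locates_from_def by blast
  have len\<sigma>: "length (\<sigma> h) = l" and set\<sigma>: "set (\<sigma> h) \<subseteq> verts H" for h
    using \<sigma> by (auto simp: cop_strategy_def)
  define \<sigma>' where "\<sigma>' h = \<sigma> (map (take l) h) @ ws" for h
  \<comment> \<open>Since \<open>0 < l\<close>, the head of an answer is the distance from a cop in \<open>H\<close>; what follows the first
    \<open>l\<close> entries are the distances from the guards.\<close>
  define P :: "enat list \<Rightarrow> bool"
    where "P a \<longleftrightarrow> hd a \<noteq> \<infinity> \<and> (\<forall>d \<in> set (drop l a). d = \<infinity>)" for a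
  have ans: "map (take l) (answers G \<sigma>' r n) = answers H \<sigma> r n"
    if "\<forall>j<n. r j \<in> verts H" for r n
    using that
  proof (induction n)
    case (Suc n)
    moreover have "map (\<lambda>u. ddist G u (r n)) (\<sigma> h) = map (\<lambda>u. ddist H u (r n)) (\<sigma> h)" for h
      using ddist_sccs[OF H] set\<sigma>[of h] Suc.prems by (intro map_cong) (auto intro!: ddist_sccs[OF H, symmetric])
    ultimately show ?case by (simp add: \<sigma>'_def len\<sigma>)
  qed simp
  show ?thesis
  proof (rule locates_from_handover[OF _ _ _ closed closed' outside])
    show "cop_strategy G k \<sigma>'"
      using \<sigma> l(2) ws sccs_verts_subset[OF H] by (auto simp: cop_strategy_def \<sigma>'_def)
  next
    fix h x assume x: "x \<in> verts G"
    let ?q = "\<sigma> (map (take l) h)"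
    have ne: "?q \<noteq> []" using len\<sigma>[of "map (take l) h"] l(1) \<open>0 < m\<close> by auto
    then have q: "hd ?q \<in> verts H" using set\<sigma> hd_in_set by blast
    have "P (map (\<lambda>u. ddist G u x) (\<sigma>' h)) \<longleftrightarrow> hd ?q \<rightarrow>\<^sup>*\<^bsub>G\<^esub> x \<and> (\<forall>w \<in> set ws. \<not> w \<rightarrow>\<^sup>*\<^bsub>G\<^esub> x)"
      using ne by (simp add: P_def \<sigma>'_def len\<sigma> hd_append hd_map ddist_eq_infinity_iff)
    also have "\<dots> \<longleftrightarrow> x \<in> verts H"
      using guard[OF q] sccs_reachable[OF H q] by blast
    finally show "P (map (\<lambda>u. ddist G u x) (\<sigma>' h)) \<longleftrightarrow> x \<in> verts H" .
  next
    fix r assume r: "robber_walk G r" "\<forall>n. r n \<in> verts H"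
    then have "robber_walk H r" using robber_walk_sccs[OF H] by blast
    from \<sigma>_win[OF this] r(2) obtain n where n: "\<And>r'. robber_walk H r' \<Longrightarrow>
          answers H \<sigma> r' (Suc n) = answers H \<sigma> r (Suc n) \<Longrightarrow> r' n = r n"
      by (metis robber_walk_def)
    have "r' n = r n" if r': "robber_walk G r'" "\<forall>j \<le> n. r' j \<in> verts H"
      "answers G \<sigma>' r' (Suc n) = answers G \<sigma>' r (Suc n)" for r'
    proof -
      \<comment> \<open>\<open>r'\<close> may leave \<open>H\<close> after round \<open>n\<close>; stopping it there makes it a walk in \<open>H\<close> without
        changing the answers up to that round.\<close>
      define s where "s j = r' (min j n)" for j
      have "robber_walk G s"
        using r'(1) by (auto simp: robber_walk_def s_def min_def not_less_eq_eq le_Suc_eq)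
      then have s: "robber_walk H s" using robber_walk_sccs[OF H, of s] r'(2) by (simp add: s_def)
      have "answers H \<sigma> s (Suc n) = answers H \<sigma> r' (Suc n)"
        by (rule answers_cong) (simp add: s_def)
      also have "\<dots> = map (take l) (answers G \<sigma>' r' (Suc n))"
        using ans[of "Suc n" r'] r'(2) by (simp del: answers.simps)
      also have "\<dots> = answers H \<sigma> r (Suc n)"
        using ans[of "Suc n" r] r(2) r'(3) by (simp del: answers.simps)
      finally have "s n = r n" by (rule n[OF s])
      then show ?thesis by (simp add: s_def)
    qed
    then show "\<exists>n. \<forall>r'. robber_walk G r' \<and> (\<forall>j \<le> n. r' j \<in> verts H) \<and>
          answers G \<sigma>' r' (Suc n) = answers G \<sigma>' r (Suc n) \<longrightarrow> r' n = r n"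
      by blast
  qed
qed

section \<open>The bound\<close>

text \<open>
  Choose \<open>u\<close> in \<open>U\<close> with the largest number of reachable vertices, and let \<open>H\<close> be its component. If an
  arc from \<open>x\<close> in \<open>U\<close> enters \<open>H\<close>, then \<open>x\<close> reaches all vertices that \<open>u\<close> reaches, so by maximality no
  others; in particular \<open>u\<close> reaches \<open>x\<close>, and \<open>x\<close> is in \<open>H\<close>.
\<close>

lemma (in fin_digraph) source_scc:
  assumes U: "U \<subseteq> verts G" "U \<noteq> {}" and closed: "\<And>x y. x \<in> U \<Longrightarrow> x \<rightarrow>\<^bsub>G\<^esub> y \<Longrightarrow> y \<in> U"
  obtains H where "H \<in> sccs" "verts H \<subseteq> U"
    "\<And>x y. x \<in> U - verts H \<Longrightarrow> x \<rightarrow>\<^bsub>G\<^esub> y \<Longrightarrow> y \<in> U - verts H"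
proof -
  have fin: "finite {v. x \<rightarrow>\<^sup>*\<^bsub>G\<^esub> v}" for x
    by (rule finite_subset[OF _ finite_verts]) (auto dest: reachable_in_verts)
  have "finite U" using U(1) finite_verts finite_subset by blast
  with U(2) obtain u where u: "u \<in> U"
    and max: "\<And>x. x \<in> U \<Longrightarrow> card {v. x \<rightarrow>\<^sup>*\<^bsub>G\<^esub> v} \<le> card {v. u \<rightarrow>\<^sup>*\<^bsub>G\<^esub> v}"
    using obtains_MAX[of U "\<lambda>x. card {v. x \<rightarrow>\<^sup>*\<^bsub>G\<^esub> v}"] Max_ge[of "(\<lambda>x. card {v. x \<rightarrow>\<^sup>*\<^bsub>G\<^esub> v}) ` U"]
    by (metis finite_imageI imageI)
  obtain H where H: "H \<in> sccs" "u \<in> verts H" using ex_scc U(1) u by blast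
  show ?thesis
  proof
    have "v \<in> U" if "u \<rightarrow>\<^sup>*\<^bsub>G\<^esub> v" for v
      using that by (induction rule: reachable_induct) (use u closed in auto)
    then show "verts H \<subseteq> U" using sccs_reachable[OF H] by blast
    fix x y assume x: "x \<in> U - verts H" and xy: "x \<rightarrow>\<^bsub>G\<^esub> y"
    have "y \<notin> verts H"
    proof
      assume "y \<in> verts H"
      then have xu: "x \<rightarrow>\<^sup>*\<^bsub>G\<^esub> u" using sccs_reachable[OF H(1) _ H(2)] adj_reachable_trans xy by blast
      then have "{v. u \<rightarrow>\<^sup>*\<^bsub>G\<^esub> v} \<subseteq> {v. x \<rightarrow>\<^sup>*\<^bsub>G\<^esub> v}" by (auto intro: reachable_trans)
      with max[of x] x have "{v. u \<rightarrow>\<^sup>*\<^bsub>G\<^esub> v} = {v. x \<rightarrow>\<^sup>*\<^bsub>G\<^esub> v}"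
        by (intro card_seteq fin) auto
      moreover have "x \<rightarrow>\<^sup>*\<^bsub>G\<^esub> x" using x U(1) by auto
      ultimately have "u \<rightarrow>\<^sup>*\<^bsub>G\<^esub> x" by blast
      with xu x show False using in_sccsI_reachable[OF H] by blast
    qed
    with closed x xy show "y \<in> U - verts H" by blast
  qed (rule H(1))
qed

lemma (in fin_digraph) locates_from_closed:
  assumes "verts G \<noteq> {}"
    and win: "\<And>H. H \<in> sccs \<Longrightarrow> \<exists>m > 0. cops_win H m \<and> m + out_degree (strong_component_digraph G) H \<le> k"
    and "U \<subseteq> verts G" "\<And>x y. x \<in> U \<Longrightarrow> x \<rightarrow>\<^bsub>G\<^esub> y \<Longrightarrow> y \<in> U"
  shows "locates_from G k U"
proof -
  have "finite U" using assms(3) finite_verts finite_subset by blast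
  then show ?thesis using assms(3,4)
  proof (induction U rule: finite_psubset_induct)
    case (psubset U)
    show ?case
    proof (cases "U = {}")
      case True
      obtain v where "v \<in> verts G" using assms(1) by auto
      then have "cop_strategy G k (\<lambda>_. replicate k v)" by (auto simp: cop_strategy_def)
      with True show ?thesis by (auto simp: locates_from_def)
    next
      case False
      obtain H where H: "H \<in> sccs" "verts H \<subseteq> U"
        and closed': "\<And>x y. x \<in> U - verts H \<Longrightarrow> x \<rightarrow>\<^bsub>G\<^esub> y \<Longrightarrow> y \<in> U - verts H"
        by (rule source_scc[OF psubset.prems(1) False], erule (1) psubset.prems(2), rule that)
      obtain m where m: "0 < m" "cops_win H m"
          "m + out_degree (strong_component_digraph G) H \<le> k"
        using win[OF H(1)] by auto
      have "verts H \<noteq> {}" using H by (auto simp: sccs_def strongly_connected_def)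
      then have "U - verts H \<subset> U" using H(2) by blast
      then have "locates_from G k (U - verts H)"
        by (rule psubset.IH[OF _ _ closed']) (use psubset.prems(1) in auto)
      with H(1) m(2,1,3) psubset.prems(2) closed' show ?thesis
        by (rule locates_from_peel_scc)
    qed
  qed
qed

text \<open>
  Apply the previous lemma to \<open>U = verts G\<close>. As \<open>localization_number\<close> is a minimum over positive
  numbers of cops, the bound itself must also be shown to be positive.
\<close>

theorem theorem6:
  fixes G :: "('a, 'b) pre_digraph"
  assumes "oriented_digraph G"
  shows "localization_number G
    \<le> Max (localization_number ` pre_digraph.sccs G)
      + max_out_degree (strong_component_digraph G)"
proof -
  interpret oriented_digraph G by fact
  let ?m = "Max (localization_number ` sccs)" and ?D = "max_out_degree (strong_component_digraph G)"
  have le: "localization_number H \<le> ?m" "out_degree (strong_component_digraph G) H \<le> ?D"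
    if "H \<in> sccs" for H
    using that finite_sccs by (auto simp: max_out_degree_def strong_component_digraph_def)
  have pos: "0 < localization_number H" "cops_win H (localization_number H)" if "H \<in> sccs" for H
    using oriented_digraph.localization_number_attained[OF sccs_oriented_digraph[OF that]] by auto
  have "cops_win G (?m + ?D)"
    unfolding cops_win_iff_locates_from_verts
  proof (rule locates_from_closed[OF verts_nonempty])
    show "\<exists>m > 0. cops_win H m \<and> m + out_degree (strong_component_digraph G) H \<le> ?m + ?D"
      if "H \<in> sccs" for H
      using pos[OF that] le[OF that] by (meson add_mono)
  qed (auto simp: adj_in_verts)
  moreover obtain H where "H \<in> sccs" using verts_nonempty ex_scc by blast
  then have "0 < ?m + ?D" using pos le by (metis add_gr_0 less_le_trans)
  ultimately show ?thesis unfolding localization_number_def[of G] by (intro Least_le) simp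
qed

end
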